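(* For $n=2$, the Gaussian curvature $K_G(\theta,\alpha)$ of the Riemannian surface $(\Omega,g_\alpha)$ at $\theta$ satisfies, for all $\theta\in\Omega$, $$K_G(\theta,0)=-\frac14,\qquad K_G(\theta,1)=+\frac14 .$$
   Context: Here $n=2$, $u:=e^{\theta^1}$, $v:=e^{\theta^2}$, $\Omega:=\{\theta=(\theta^1,\theta^2)\in\mathbb R^2: u+v<1\}$, $\Psi_+(\theta):=\log(1+u+v)$, $\Psi_-(\theta):=-\log(1-u-v)$, and for $\alpha\in[0,1]$, $\Psi_\alpha:=\alpha\Psi_++(1-\alpha)\Psi_-$. The Riemannian metric $g_\alpha$ on $\Omega$ has matrix $g_\alpha(\theta)=\operatorname{Hess}_\theta\Psi_\alpha(\theta)$ in the coordinates $(\theta^1,\theta^2)$. $K_G(\theta,\alpha)$ denotes the Gaussian curvature of $g_\alpha$ (Levi-Civita) at the point $\theta$. *)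

theory Defs
  imports "HOL-Analysis.Analysis"
begin

text \<open>
  A Riemannian metric on an open subset of \<open>real ^ 'n\<close> is given by its coordinate matrix
  \<open>g :: real ^ 'n \<Rightarrow> real ^ 'n ^ 'n\<close>. Functions are total; since derivatives only depend on the
  germ at a point, the values outside the open set are irrelevant to everything below at its points.
\<close>

definition partial_deriv :: "'n \<Rightarrow> (real ^ 'n \<Rightarrow> real) \<Rightarrow> real ^ 'n \<Rightarrow> real" where
  "partial_deriv i f x = deriv (\<lambda>t. f (x + t *\<^sub>R axis i 1)) 0"

definition Hess :: "(real ^ 'n \<Rightarrow> real) \<Rightarrow> real ^ 'n \<Rightarrow> real ^ 'n ^ 'n" where
  "Hess f x = (\<chi> i j. partial_deriv i (partial_deriv j f) x)"

text \<open>\<open>christoffel g k i j\<close> is $\Gamma^k_{ij}$, so that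
  $\nabla_{\partial_i} \partial_j = \sum_k \Gamma^k_{ij} \partial_k$ for the Levi-Civita
  connection of \<open>g\<close>.\<close>

definition christoffel ::
  "(real ^ 'n \<Rightarrow> real ^ 'n ^ 'n) \<Rightarrow> 'n \<Rightarrow> 'n \<Rightarrow> 'n \<Rightarrow> real ^ 'n \<Rightarrow> real" where
  "christoffel g k i j x =
     (1 / 2) * (\<Sum>l\<in>UNIV. matrix_inv (g x) $ k $ l *
       (partial_deriv i (\<lambda>y. g y $ j $ l) x
        + partial_deriv j (\<lambda>y. g y $ i $ l) x
        - partial_deriv l (\<lambda>y. g y $ i $ j) x))"

text \<open>\<open>riemann g l k i j\<close> is $R^l{}_{kij}$ with the convention
  $R(\partial_i, \partial_j) \partial_k = \sum_l R^l{}_{kij} \partial_l$ and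
  $R(X, Y) Z = \nabla_X \nabla_Y Z - \nabla_Y \nabla_X Z - \nabla_{[X, Y]} Z$.\<close>

definition riemann ::
  "(real ^ 'n \<Rightarrow> real ^ 'n ^ 'n) \<Rightarrow> 'n \<Rightarrow> 'n \<Rightarrow> 'n \<Rightarrow> 'n \<Rightarrow> real ^ 'n \<Rightarrow> real" where
  "riemann g l k i j x =
     partial_deriv i (christoffel g l j k) x - partial_deriv j (christoffel g l i k) x
     + (\<Sum>m\<in>UNIV. christoffel g l i m x * christoffel g m j k x
                - christoffel g l j m x * christoffel g m i k x)"

text \<open>$K = \langle R(\partial_1, \partial_2) \partial_2, \partial_1 \rangle / \det g$; with the
  sign convention above the round unit sphere has $K = 1$.\<close>

definition gaussian_curvature :: "(real ^ 2 \<Rightarrow> real ^ 2 ^ 2) \<Rightarrow> real ^ 2 \<Rightarrow> real" where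
  "gaussian_curvature g x =
     (\<Sum>l\<in>UNIV. g x $ l $ 1 * riemann g l 2 1 2 x) / det (g x)"

definition Omega :: "(real ^ 2) set" where
  "Omega = {\<theta>. exp (\<theta> $ 1) + exp (\<theta> $ 2) < 1}"

definition Psi_plus :: "real ^ 2 \<Rightarrow> real" where
  "Psi_plus \<theta> = ln (1 + exp (\<theta> $ 1) + exp (\<theta> $ 2))"

definition Psi_minus :: "real ^ 2 \<Rightarrow> real" where
  "Psi_minus \<theta> = - ln (1 - exp (\<theta> $ 1) - exp (\<theta> $ 2))"

definition Psi :: "real \<Rightarrow> real ^ 2 \<Rightarrow> real" where
  "Psi \<alpha> \<theta> = \<alpha> * Psi_plus \<theta> + (1 - \<alpha>) * Psi_minus \<theta>"

definition g_alpha :: "real \<Rightarrow> real ^ 2 \<Rightarrow> real ^ 2 ^ 2" where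
  "g_alpha \<alpha> \<theta> = Hess (Psi \<alpha>) \<theta>"

definition K_G :: "real ^ 2 \<Rightarrow> real \<Rightarrow> real" where
  "K_G \<theta> \<alpha> = gaussian_curvature (g_alpha \<alpha>) \<theta>"

end

theory Submission
  imports Defs
begin

text \<open>
  The potentials at \<open>\<alpha> = 1\<close> and \<open>\<alpha> = 0\<close> are the cases \<open>s = 1\<close> and \<open>s = -1\<close> of
  \<open>s ln (1 + s (u + v))\<close>. Since \<open>s\<^sup>2 = 1\<close>, its gradient \<open>p\<close> satisfies
  \<open>\<partial>\<^sub>i p\<^sub>j = \<delta>\<^sub>i\<^sub>j p\<^sub>j - s p\<^sub>i p\<^sub>j\<close>, so all further derivatives are polynomials in \<open>p\<close>.
  The Sherman-Morrison formula inverts the metric and makes the Christoffel symbols affine in \<open>p\<close>: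
  \<open>2 \<Gamma>\<^sup>k\<^sub>i\<^sub>j = \<delta>\<^sub>i\<^sub>j \<delta>\<^sub>i\<^sub>k - s (p\<^sub>j \<delta>\<^sub>i\<^sub>k + p\<^sub>i \<delta>\<^sub>j\<^sub>k)\<close>. The curvature is then \<open>s / 4\<close>.
\<close>

lemma partial_deriv_eqI:
  assumes "((\<lambda>t. f (x + t *\<^sub>R axis i 1)) has_real_derivative d) (at 0)"
  shows "partial_deriv i f x = d"
  using assms unfolding partial_deriv_def by (rule DERIV_imp_deriv)

text \<open>Partial derivatives see only germs, so a closed form proved on an open domain may be
  substituted before differentiating again.\<close>

lemma partial_deriv_cong_open:
  fixes x :: "real ^ 'n"
  assumes "open S" "x \<in> S" "\<And>y. y \<in> S \<Longrightarrow> f y = g y"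
  shows "partial_deriv i f x = partial_deriv i g x"
proof -
  have "((\<lambda>t. x + t *\<^sub>R axis i 1) \<longlongrightarrow> x + 0 *\<^sub>R axis i 1) (nhds (0::real))"
    by (intro tendsto_intros filterlim_ident)
  then have "\<forall>\<^sub>F t in nhds (0::real). x + t *\<^sub>R axis i 1 \<in> S"
    using assms(1,2) by (simp add: topological_tendstoD)
  then have "\<forall>\<^sub>F t in nhds (0::real). f (x + t *\<^sub>R axis i 1) = g (x + t *\<^sub>R axis i 1)"
    by eventually_elim (rule assms(3))
  then show ?thesis
    unfolding partial_deriv_def by (rule deriv_cong_ev) simp
qed

lemma component_deriv [derivative_intros]:
  "((\<lambda>t. (x + t *\<^sub>R axis i 1) $ j) has_real_derivative (if i = j then 1 else 0)) (at a)"
  by (auto intro!: derivative_eq_intros simp: axis_def)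

definition denom :: "real \<Rightarrow> real ^ 2 \<Rightarrow> real" where
  "denom s x = 1 + s * (exp (x $ 1) + exp (x $ 2))"

text \<open>The whole plane for \<open>s = 1\<close>, and \<open>Omega\<close> for
  \<open>s = -1\<close>.\<close>

definition pot_domain :: "real \<Rightarrow> (real ^ 2) set" where
  "pot_domain s = {x. denom s x > 0}"

definition pot :: "real \<Rightarrow> real ^ 2 \<Rightarrow> real" where
  "pot s x = s * ln (denom s x)"

definition grad :: "real \<Rightarrow> 2 \<Rightarrow> real ^ 2 \<Rightarrow> real" where
  "grad s i x = exp (x $ i) / denom s x"

lemma open_pot_domain: "open (pot_domain s)"
  unfolding pot_domain_def denom_def by (intro open_Collect_less continuous_intros)

lemma denom_deriv:
  "((\<lambda>t. denom s (x + t *\<^sub>R axis i 1)) has_real_derivative s * exp (x $ i)) (at 0)"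
proof -
  have "i = 1 \<or> i = 2" by (rule exhaust_2)
  then show ?thesis
    unfolding denom_def
    by (intro derivative_eq_intros component_deriv | force)+
qed

text \<open>Quotient rule: \<open>denom\<close> has logarithmic derivative
  \<open>s * grad s i x\<close> in direction \<open>i\<close>.\<close>

lemma grad_deriv:
  assumes "x \<in> pot_domain s"
  shows "((\<lambda>t. grad s j (x + t *\<^sub>R axis i 1)) has_real_derivative
    (if i = j then grad s j x else 0) - s * grad s i x * grad s j x) (at 0)"
proof -
  have "denom s x > 0" using assms by (simp add: pot_domain_def)
  then show ?thesis
    unfolding grad_def
    by (intro DERIV_cong[OF DERIV_divide[OF DERIV_fun_exp[OF component_deriv] denom_deriv]])
      (auto simp: field_simps)
qed

text \<open>One factor \<open>s\<close> comes from \<open>pot\<close>, the other from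
  differentiating \<open>denom\<close>; their product is 1.\<close>

lemma partial_deriv_pot:
  assumes "s * s = 1" "x \<in> pot_domain s"
  shows "partial_deriv i (pot s) x = grad s i x"
proof (rule partial_deriv_eqI)
  have "denom s x > 0" using assms by (simp add: pot_domain_def)
  then show "((\<lambda>t. pot s (x + t *\<^sub>R axis i 1)) has_real_derivative grad s i x) (at 0)"
    unfolding pot_def grad_def using assms(1)
    by (auto intro!: derivative_eq_intros denom_deriv simp: field_simps)
qed

lemma Hess_pot:
  assumes "s * s = 1" "x \<in> pot_domain s"
  shows "Hess (pot s) x $ i $ j = (if i = j then grad s j x else 0) - s * grad s i x * grad s j x"
proof -
  have "partial_deriv i (partial_deriv j (pot s)) x = partial_deriv i (grad s j) x"
    by (rule partial_deriv_cong_open[OF open_pot_domain assms(2)]) (rule partial_deriv_pot[OF assms(1)])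
  then show ?thesis
    by (simp add: Hess_def partial_deriv_eqI[OF grad_deriv[OF assms(2)]])
qed

lemma partial_deriv_Hess_pot:
  assumes "s * s = 1" "x \<in> pot_domain s"
  shows "partial_deriv k (\<lambda>y. Hess (pot s) y $ i $ j) x =
    (if i = j then (if k = j then grad s j x else 0) - s * grad s k x * grad s j x else 0)
    - s * (((if k = i then grad s i x else 0) - s * grad s k x * grad s i x) * grad s j x
       + grad s i x * ((if k = j then grad s j x else 0) - s * grad s k x * grad s j x))"
proof -
  have "partial_deriv k (\<lambda>y. Hess (pot s) y $ i $ j) x =
      partial_deriv k (\<lambda>y. (if i = j then grad s j y else 0) - s * grad s i y * grad s j y) x"
    by (rule partial_deriv_cong_open[OF open_pot_domain assms(2)]) (rule Hess_pot[OF assms(1)])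
  also have "\<dots> = (if i = j then (if k = j then grad s j x else 0) - s * grad s k x * grad s j x else 0)
    - s * (((if k = i then grad s i x else 0) - s * grad s k x * grad s i x) * grad s j x
       + grad s i x * ((if k = j then grad s j x else 0) - s * grad s k x * grad s j x))"
    by (rule partial_deriv_eqI)
      (cases "i = j"; auto intro!: derivative_eq_intros grad_deriv[OF assms(2)] simp: algebra_simps)
  finally show ?thesis .
qed

lemma grad_pos: "x \<in> pot_domain s \<Longrightarrow> grad s i x > 0"
  by (simp add: grad_def pot_domain_def)

text \<open>The quantity equals \<open>1 / denom s x\<close>. It is the Sherman-Morrison denominator
  and a factor of the determinant, so it must not vanish.\<close>

lemma grad_rest:
  assumes "x \<in> pot_domain s"
  shows "1 - s * (grad s 1 x + grad s 2 x) > 0"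
proof -
  have "denom s x > 0" using assms by (simp add: pot_domain_def)
  moreover from this have "1 - s * (grad s 1 x + grad s 2 x) = 1 / denom s x"
    by (simp add: grad_def field_simps) (simp add: denom_def field_simps)
  ultimately show ?thesis by simp
qed

text \<open>\<open>matrix_inv\<close> chooses a two-sided inverse. A right inverse of a square
  matrix is two-sided, so such a choice exists, and inverses are unique.\<close>

lemma matrix_inv_eqI:
  fixes A B :: "real ^ 'n ^ 'n"
  assumes "A ** B = mat 1"
  shows "matrix_inv A = B"
proof -
  have "B ** A = mat 1"
    using assms by (simp add: matrix_left_right_inverse)
  then have "matrix_inv A ** A = mat 1"
    unfolding matrix_inv_def using assms by (metis (mono_tags, lifting) someI_ex)
  then show ?thesis
    using assms by (metis matrix_mul_assoc matrix_mul_lid matrix_mul_rid)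
qed

text \<open>The metric is \<open>D - s p p^T\<close> with \<open>D\<close> the diagonal matrix of
  \<open>p\<close>. The inverse of \<open>D\<close> maps \<open>p\<close> to the all-ones vector, so
  the Sherman-Morrison correction has all entries equal.\<close>

lemma matrix_inv_Hess_pot:
  assumes "s * s = 1" "x \<in> pot_domain s"
  shows "matrix_inv (Hess (pot s) x) $ i $ j =
    (if i = j then 1 / grad s i x else 0) + s / (1 - s * (grad s 1 x + grad s 2 x))"
proof -
  define p q r where "p = grad s 1 x" and "q = grad s 2 x" and "r = 1 - s * (p + q)"
  have pos: "p > 0" "q > 0" "r > 0"
    using grad_pos[OF assms(2)] grad_rest[OF assms(2)] by (auto simp: p_def q_def r_def)
  define B :: "real^2^2" where
    "B = (\<chi> i j. (if i = j then 1 / grad s i x else 0) + s / r)"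
  have "Hess (pot s) x ** B = mat 1"
    using pos
    by (auto simp: vec_eq_iff forall_2 matrix_matrix_mult_def sum_2 B_def mat_def Hess_pot[OF assms]
        p_def[symmetric] q_def[symmetric] field_simps)
      (simp_all add: r_def algebra_simps)
  then have "matrix_inv (Hess (pot s) x) = B"
    by (rule matrix_inv_eqI)
  then show ?thesis by (simp add: B_def r_def p_def q_def)
qed

lemma christoffel_pot:
  assumes "s * s = 1" "x \<in> pot_domain s"
  shows "christoffel (Hess (pot s)) k i j x =
    (1 / 2) * ((if i = j \<and> i = k then 1 else 0)
      - s * ((if i = k then grad s j x else 0) + (if j = k then grad s i x else 0)))"
proof -
  define p where "p i = grad s i x" for i
  define r where "r = 1 - s * (p 1 + p 2)"
  \<comment> \<open>A Hessian metric has totally symmetric first derivatives, so the Christoffel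
    bracket is a single third derivative of the potential. Each of its terms contains
    \<open>p l\<close>, and \<open>C l\<close> is the quotient.\<close>
  define C where "C l = (if i = j \<and> i = l then 1 else 0) - s * (if i = j then p i else 0)
    - s * ((if i = l then p j else 0) + (if j = l then p i else 0)) + 2 * p i * p j" for l
  have pos: "p l > 0" "r > 0" for l
    using grad_pos[OF assms(2)] grad_rest[OF assms(2)] by (auto simp: p_def r_def)
  \<comment> \<open>\<open>s * s = 1\<close> in the right-nested form that
    \<open>algebra_simps\<close> produces.\<close>
  have s2: "s * (s * y) = y" for y
    using assms(1) by (metis mult.assoc mult_1)
  have C: "partial_deriv i (\<lambda>y. Hess (pot s) y $ j $ l) x
      + partial_deriv j (\<lambda>y. Hess (pot s) y $ i $ l) x
      - partial_deriv l (\<lambda>y. Hess (pot s) y $ i $ j) x = p l * C l" for l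
    by (cases "i = j"; cases "j = l"; cases "i = l")
      (simp_all add: partial_deriv_Hess_pot[OF assms] C_def p_def algebra_simps s2)
  \<comment> \<open>The factor \<open>r\<close> cancels the denominator of the rank-one part of the
    inverse.\<close>
  have sum_C: "(\<Sum>l\<in>UNIV. p l * C l) = r * ((if i = j then p i else 0) - 2 * s * p i * p j)"
    using exhaust_2[of i] exhaust_2[of j]
    by (auto simp: sum_2 C_def r_def algebra_simps s2)
  have "(\<Sum>l\<in>UNIV. matrix_inv (Hess (pot s) x) $ k $ l * (p l * C l)) =
      (\<Sum>l\<in>UNIV. if l = k then C l else 0) + s / r * (\<Sum>l\<in>UNIV. p l * C l)"
    unfolding sum_distrib_left sum.distrib[symmetric] matrix_inv_Hess_pot[OF assms]
      p_def[symmetric] r_def[symmetric]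
    using pos(1) by (intro sum.cong) (auto simp: distrib_right less_imp_neq[THEN not_sym])
  also have "\<dots> = C k + s * ((if i = j then p i else 0) - 2 * s * p i * p j)"
    unfolding sum_C using pos(2) by simp
  finally have contraction: "(\<Sum>l\<in>UNIV. matrix_inv (Hess (pot s) x) $ k $ l * (p l * C l)) =
      C k + s * ((if i = j then p i else 0) - 2 * s * p i * p j)" .
  \<comment> \<open>The term added to \<open>C k\<close> cancels its quadratic part and the summand
    conditioned on \<open>i = j\<close> alone.\<close>
  show ?thesis
    unfolding christoffel_def C contraction by (simp add: C_def p_def algebra_simps s2)
qed

lemma partial_deriv_christoffel_pot:
  assumes "s * s = 1" "x \<in> pot_domain s"
  shows "partial_deriv m (christoffel (Hess (pot s)) k i j) x =
    - (s / 2) * ((if i = k then (if m = j then grad s j x else 0) - s * grad s m x * grad s j x else 0)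
      + (if j = k then (if m = i then grad s i x else 0) - s * grad s m x * grad s i x else 0))"
proof -
  have "partial_deriv m (christoffel (Hess (pot s)) k i j) x =
    partial_deriv m (\<lambda>x. (1 / 2) * ((if i = j \<and> i = k then 1 else 0)
      - s * ((if i = k then grad s j x else 0) + (if j = k then grad s i x else 0)))) x"
    by (rule partial_deriv_cong_open[OF open_pot_domain assms(2)]) (rule christoffel_pot[OF assms(1)])
  also have "\<dots> = - (s / 2) *
      ((if i = k then (if m = j then grad s j x else 0) - s * grad s m x * grad s j x else 0)
      + (if j = k then (if m = i then grad s i x else 0) - s * grad s m x * grad s i x else 0))"
    by (rule partial_deriv_eqI)
      (cases "i = k"; cases "j = k";
        auto intro!: derivative_eq_intros grad_deriv[OF assms(2)] simp: field_simps)
  finally show ?thesis .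
qed

lemma gaussian_curvature_pot:
  assumes "s * s = 1" "x \<in> pot_domain s"
  shows "gaussian_curvature (Hess (pot s)) x = s / 4"
proof -
  define p q r where "p = grad s 1 x" and "q = grad s 2 x" and "r = 1 - s * (p + q)"
  have pos: "p > 0" "q > 0" "r > 0"
    using grad_pos[OF assms(2)] grad_rest[OF assms(2)] by (auto simp: p_def q_def r_def)
  have s2: "s * (s * y) = y" for y
    using assms(1) by (metis mult.assoc mult_1)
  \<comment> \<open>Matrix determinant lemma for a diagonal matrix plus a rank-one term.\<close>
  have det: "det (Hess (pot s) x) = p * q * r"
    by (simp add: det_2 Hess_pot[OF assms] p_def[symmetric] q_def[symmetric] r_def algebra_simps s2)
  have R1: "riemann (Hess (pot s)) 1 2 1 2 x = s * q * (1 - s * q) / 4"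
    by (simp add: riemann_def sum_2 christoffel_pot[OF assms] partial_deriv_christoffel_pot[OF assms]
        p_def[symmetric] q_def[symmetric] field_simps s2)
  have R2: "riemann (Hess (pot s)) 2 2 1 2 x = p * q / 4"
    by (simp add: riemann_def sum_2 christoffel_pot[OF assms] partial_deriv_christoffel_pot[OF assms]
        p_def[symmetric] q_def[symmetric] field_simps s2)
  \<comment> \<open>Taking out \<open>s * p * q / 4\<close> leaves
    \<open>(1 - s * p) * (1 - s * q) - p * q\<close>, which is \<open>r\<close> because
    \<open>s * s = 1\<close>.\<close>
  have "(\<Sum>l\<in>UNIV. Hess (pot s) x $ l $ 1 * riemann (Hess (pot s)) l 2 1 2 x) = s / 4 * (p * q * r)"
    by (simp add: sum_2 R1 R2 Hess_pot[OF assms] p_def[symmetric] q_def[symmetric] r_def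
        field_simps s2)
  then show ?thesis
    using pos by (simp add: gaussian_curvature_def det)
qed

theorem theorem2p2:
  fixes \<theta> :: "real ^ 2"
  assumes "\<theta> \<in> Omega"
  shows "K_G \<theta> 0 = - (1 / 4) \<and> K_G \<theta> 1 = 1 / 4"
proof
  \<comment> \<open>The other potential has weight 0, so the equality holds on the whole plane,
    including where \<open>ln\<close> has a nonpositive argument.\<close>
  have "Psi 0 = pot (- 1)"
    by (simp add: Psi_def Psi_minus_def pot_def denom_def fun_eq_iff algebra_simps)
  then have "g_alpha 0 = Hess (pot (- 1))"
    by (intro ext) (simp add: g_alpha_def)
  moreover have "\<theta> \<in> pot_domain (- 1)"
    using assms by (simp add: Omega_def pot_domain_def denom_def)
  ultimately show "K_G \<theta> 0 = - (1 / 4)"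
    by (simp add: K_G_def gaussian_curvature_pot)
  have "Psi 1 = pot 1"
    by (simp add: Psi_def Psi_plus_def pot_def denom_def fun_eq_iff algebra_simps)
  then have "g_alpha 1 = Hess (pot 1)"
    by (intro ext) (simp add: g_alpha_def)
  moreover have "\<theta> \<in> pot_domain 1"
    by (simp add: pot_domain_def denom_def add_pos_pos)
  ultimately show "K_G \<theta> 1 = 1 / 4"
    by (simp add: K_G_def gaussian_curvature_pot)
qed

end
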